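(* Let $\mathcal{H}$ be a real Hilbert space, and let $f_1,\dots,f_m:\mathcal{H}\to\mathbb{R}$ be convex and differentiable with globally $L$-Lipschitz continuous gradients, $L>0$; write $f=(f_1,\dots,f_m)$. Let $0<s\le\frac1L$, $x^0=x^1\in\mathcal{H}$, and for $k\ge1$ define $$y^k=x^k+\tfrac{k-1}{k+2}(x^k-x^{k-1}),\qquad x^{k+1}=y^k-s\sum_{i=1}^m\theta_i^k\nabla f_i(y^k),$$ where $\theta^k\in\mathbb{R}^m$ is a solution of $$\min_{\theta\in\mathbb{R}^m}\Big\|s\Big(\sum_{i=1}^m\theta_i\nabla f_i(y^k)\Big)-\tfrac{k-1}{k+2}(x^k-x^{k-1})\Big\|^2\quad\text{s.t. }\theta\ge0,\ \sum_{i=1}^m\theta_i=1.$$ Let $\mathcal{L}(f(x^0))=\{x\in\mathcal{H}: f_i(x)\le f_i(x^0)\text{ for all }i=1,\dots,m\}$, let $P_w$ be the set of weakly Pareto optimal points and $\mathcal{L}^*=P_w\cap\mathcal{L}(f(x^0))$. Assume that for every $x\in\mathcal{L}(f(x^0))$ there exists $x^*\in\mathcal{L}^*$ with $f(x^* )\le f(x)$ (componentwise), and that $$\sup_{f^*\in f(\mathcal{L}^* )}\ \inf_{x\in f^{-1}(\{f^*\})}\|x-x^0\|<+\infty.$$ Then there exists $R\ge0$ such that for all $k\ge1$ $$\sup_{z\in\mathcal{H}}\ \min_{i=1,\dots,m}\big(f_i(x^k)-f_i(z)\big)\le\frac{R}{(k+1)^2}.$$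
   Context: A point $x^*\in\mathcal{H}$ is weakly Pareto optimal if there is no $x\in\mathcal{H}$ with $f_i(x)<f_i(x^* )$ for all $i=1,\dots,m$. *)

theory Defs
  imports "HOL-Analysis.Analysis"
begin

definition weakly_pareto :: "('a \<Rightarrow> real ^ 'm) \<Rightarrow> 'a set" where
  "weakly_pareto f = {x. \<not> (\<exists>z. \<forall>i. f z $ i < f x $ i)}"

definition lower_level_set :: "('a \<Rightarrow> real ^ 'm) \<Rightarrow> real ^ 'm \<Rightarrow> 'a set" where
  "lower_level_set f a = {x. \<forall>i. f x $ i \<le> a $ i}"

definition std_simplex :: "(real ^ 'm) set" where
  "std_simplex = {\<theta>. (\<forall>i. 0 \<le> \<theta> $ i) \<and> (\<Sum>i\<in>UNIV. \<theta> $ i) = 1}"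

(* Only used for k >= 1: at k = 0 the index k - 1 truncates. *)
definition momentum :: "(nat \<Rightarrow> 'a::real_vector) \<Rightarrow> nat \<Rightarrow> 'a" where
  "momentum x k = ((real k - 1) / (real k + 2)) *\<^sub>R (x k - x (k - 1))"

end

theory Submission imports Defs begin

text \<open>
  The argument is a multiobjective version of the energy proof for Nesterov's accelerated gradient
  method. Write \<open>\<sigma>\<^sub>k(z)\<close> for the smallest of the numbers \<open>f\<^sub>i(x\<^sup>k) - f\<^sub>i(z)\<close>, \<open>m\<close> for the
  momentum, \<open>g\<close> for the convex combination of gradients used in step \<open>k\<close>, and
  \<open>v\<^sub>k = x\<^sup>k - x\<^sup>k\<^sup>-\<^sup>1\<close>. Two estimates describe one step.

  \<^item> Since \<open>x\<^sup>k - x\<^sup>k\<^sup>+\<^sup>1\<close> is the shortest vector in the convex hull of the vectors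
    \<open>s\<nabla>f\<^sub>i(y\<^sup>k) - m\<close>, the variational inequality for this projection lets \<open>g\<close> replace every single
    gradient in the descent estimate along \<open>x\<^sup>k\<^sup>+\<^sup>1 - x\<^sup>k\<close>. So every component, and hence
    \<open>\<sigma>(z)\<close>, changes by at most \<open>(\<parallel>m\<parallel>\<^sup>2 - \<parallel>v\<^sub>k\<^sub>+\<^sub>1\<parallel>\<^sup>2) / 2s\<close> (lemmas \<open>simplex_min_norm_variational\<close>,
    \<open>component_decrease\<close>).
  \<^item> A minimum is below every convex combination, so \<open>\<sigma>\<^sub>k\<^sub>+\<^sub>1(z)\<close> obeys the usual bound for a gradient
    step with \<open>g\<close> from \<open>y\<^sup>k\<close> (lemma \<open>gap_after_gradient_step\<close>).

  Put \<open>T = (k + 2)/2\<close>. The first estimate with weight \<open>T(T - 1)\<close> and the second with weight \<open>T\<close> add up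
  to a difference of squared distances to \<open>z\<close>. This alone gives a left side
  \<open>T\<^sup>2\<sigma>\<^sub>k\<^sub>+\<^sub>1 - T(T - 1)\<sigma>\<^sub>k\<close>, which telescopes only up to the term \<open>\<sigma>\<^sub>k/4\<close>. For a single objective and a
  minimiser \<open>z\<close> that term has a good sign, but with several objectives \<open>\<sigma>\<^sub>k(z)\<close> may be negative.
  The remedy is to use the first estimate with an extra weight \<open>k/4\<close>: the coefficient of \<open>\<sigma>\<^sub>k\<close> becomes
  exactly \<open>k(k + 3)/4\<close> on both sides of the step, at the price of velocity terms that telescope
  because the momentum factor \<open>(k - 1)/(k + 2)\<close> is small enough. The resulting \<open>energy\<close> is
  nonincreasing for every \<open>z\<close>, whatever the sign of \<open>\<sigma>\<^sub>k(z)\<close> (lemma \<open>energy_decrease\<close>), so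
  \<open>\<sigma>\<^sub>k(z)\<close> is bounded above by a multiple of \<open>1/k\<^sup>2\<close> that depends only on \<open>\<parallel>z - x\<^sup>0\<parallel>\<close> and the data at \<open>x\<^sup>0\<close>.

  Uniformity in \<open>z\<close> comes from the last two hypotheses. If \<open>\<sigma>\<^sub>k(z) > 0\<close>, then \<open>z\<close> lies in the level set
  of \<open>x\<^sup>0\<close>, because the first estimate keeps all iterates there. So \<open>z\<close> is dominated by a weakly Pareto
  optimal point, which can be replaced by a point with the same objective values at bounded
  distance from \<open>x\<^sup>0\<close>; neither replacement decreases \<open>\<sigma>\<^sub>k\<close>.
\<close>

section \<open>Smooth convex functions on an inner product space\<close>

text \<open>Restricting to the line through the two points reduces this to the tangent inequality for
  convex functions of one real variable.\<close>

lemma gradient_inequality: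
  fixes h :: "'a::real_inner \<Rightarrow> real"
  assumes convex: "convex_on UNIV h"
    and grad: "GDERIV h y :> D"
  shows "D \<bullet> (z - y) \<le> h z - h y"
proof -
  define p where "p = (\<lambda>t. h (y + t *\<^sub>R (z - y)))"
  have "convex_on UNIV p"
  proof (rule convex_onI)
    fix t a b :: real
    assume t: "0 < t" "t < 1"
    have "y + ((1 - t) *\<^sub>R a + t *\<^sub>R b) *\<^sub>R (z - y)
        = (1 - t) *\<^sub>R (y + a *\<^sub>R (z - y)) + t *\<^sub>R (y + b *\<^sub>R (z - y))"
      by (simp add: algebra_simps)
    with convex_onD[OF convex, of t "y + a *\<^sub>R (z - y)" "y + b *\<^sub>R (z - y)"] t
    show "p ((1 - t) *\<^sub>R a + t *\<^sub>R b) \<le> (1 - t) * p a + t * p b"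
      by (simp add: p_def)
  qed simp
  moreover have "(p has_field_derivative (D \<bullet> (z - y))) (at 0)"
  proof -
    have "((\<lambda>t. y + t *\<^sub>R (z - y)) has_derivative (\<lambda>t. t *\<^sub>R (z - y))) (at (0::real))"
      by (auto intro!: derivative_eq_intros)
    moreover have "(h has_derivative (\<lambda>w. w \<bullet> D)) (at (y + 0 *\<^sub>R (z - y)))"
      using grad by (simp add: gderiv_def)
    ultimately have "(p has_derivative (\<lambda>t. (t *\<^sub>R (z - y)) \<bullet> D)) (at 0)"
      unfolding p_def by (rule has_derivative_compose)
    then show ?thesis
      by (simp add: has_field_derivative_def inner_commute mult_commute_abs)
  qed
  ultimately have "D \<bullet> (z - y) * (1 - 0) \<le> p 1 - p 0"
    by (intro convex_on_imp_above_tangent[where A = UNIV]) auto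
  then show ?thesis by (simp add: p_def)
qed

text \<open>Along the segment from \<open>y\<close> to \<open>z\<close>, the difference between the function and its quadratic model
  has nonpositive derivative, by the Lipschitz bound and the Cauchy-Schwarz inequality. This avoids
  integrating the gradient.\<close>

lemma descent_lemma:
  fixes h :: "'a::real_inner \<Rightarrow> real"
  assumes grad: "\<And>w. GDERIV h w :> D w"
    and lip: "L-lipschitz_on UNIV D"
  shows "h z \<le> h y + D y \<bullet> (z - y) + L / 2 * (norm (z - y))\<^sup>2"
proof -
  define d where "d = z - y"
  define p where "p = (\<lambda>t. h (y + t *\<^sub>R d) - t * (D y \<bullet> d) - L / 2 * t\<^sup>2 * (norm d)\<^sup>2)"
  have deriv: "(p has_real_derivative (D (y + t *\<^sub>R d) \<bullet> d - D y \<bullet> d - L * t * (norm d)\<^sup>2)) (at t)" for t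
  proof -
    have "((\<lambda>t. y + t *\<^sub>R d) has_derivative (\<lambda>t. t *\<^sub>R d)) (at t)"
      by (auto intro!: derivative_eq_intros)
    moreover have "(h has_derivative (\<lambda>w. w \<bullet> D (y + t *\<^sub>R d))) (at (y + t *\<^sub>R d))"
      using grad by (simp add: gderiv_def)
    ultimately have "((\<lambda>t. h (y + t *\<^sub>R d)) has_derivative (\<lambda>r. (r *\<^sub>R d) \<bullet> D (y + t *\<^sub>R d))) (at t)"
      by (rule has_derivative_compose)
    then have *: "((\<lambda>t. h (y + t *\<^sub>R d)) has_real_derivative (D (y + t *\<^sub>R d) \<bullet> d)) (at t)"
      by (simp add: has_field_derivative_def inner_commute mult_commute_abs)
    show ?thesis unfolding p_def
      by (rule derivative_eq_intros * refl | simp)+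
  qed
  have "p 1 \<le> p 0"
  proof (rule DERIV_nonpos_imp_nonincreasing[where f = p and a = 0 and b = 1])
    fix t :: real assume t: "0 \<le> t" "t \<le> 1"
    have "(D (y + t *\<^sub>R d) - D y) \<bullet> d \<le> norm (D (y + t *\<^sub>R d) - D y) * norm d"
      by (rule norm_cauchy_schwarz)
    also have "norm (D (y + t *\<^sub>R d) - D y) \<le> L * norm (t *\<^sub>R d)"
      using lipschitz_onD[OF lip, of "y + t *\<^sub>R d" y] by (simp add: dist_norm)
    finally have "(D (y + t *\<^sub>R d) - D y) \<bullet> d \<le> L * t * (norm d)\<^sup>2"
      using t by (simp add: mult_right_mono power2_eq_square mult.assoc)
    then show "\<exists>r. (p has_real_derivative r) (at t) \<and> r \<le> 0"
      using deriv[of t] by (intro exI conjI) (auto simp: inner_diff_left)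
  qed simp
  then show ?thesis by (simp add: p_def d_def)
qed

section \<open>The minimal norm problem over the simplex\<close>

text \<open>The vector \<open>s g - m\<close> is the point of smallest norm in a convex set having \<open>s p\<^sub>j - m\<close> as a member.
  If the inequality failed, a short move of \<open>\<theta>\<close> towards the vertex \<open>j\<close> of the simplex would
  decrease the norm.\<close>

lemma simplex_min_norm_variational:
  fixes p :: "'m::finite \<Rightarrow> 'a::real_inner" and m :: 'a
  assumes "is_arg_min (\<lambda>t. (norm (s *\<^sub>R (\<Sum>i\<in>UNIV. t $ i *\<^sub>R p i) - m))\<^sup>2)
      (\<lambda>t. t \<in> std_simplex) \<theta>"
  defines "g \<equiv> \<Sum>i\<in>UNIV. \<theta> $ i *\<^sub>R p i"
  shows "0 \<le> (s *\<^sub>R g - m) \<bullet> (s *\<^sub>R (p j - g))"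
proof (rule ccontr)
  let ?w = "s *\<^sub>R g - m" and ?d = "s *\<^sub>R (p j - g)"
  assume "\<not> 0 \<le> ?w \<bullet> ?d"
  then have "0 < (0 - ?w) \<bullet> ((?w + ?d) - ?w)"
    by (simp only: diff_0 inner_minus_left add_diff_cancel_left' neg_0_less_iff_less not_le)
  from closer_point_lemma[OF this] obtain u
    where u: "u > 0" "u \<le> 1" "dist (?w + u *\<^sub>R ((?w + ?d) - ?w)) 0 < dist ?w 0"
    by blast
  define t where "t = (1 - u) *\<^sub>R \<theta> + u *\<^sub>R axis j 1"
  have \<theta>: "\<theta> \<in> std_simplex"
    using assms(1) by (simp add: is_arg_min_def)
  have tj: "t $ i = (1 - u) * \<theta> $ i + (if i = j then u else 0)" for i
    by (simp add: t_def axis_def)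
  have "t \<in> std_simplex"
    using \<theta> u by (auto simp: std_simplex_def tj sum.distrib simp flip: sum_distrib_left)
  moreover have "(\<Sum>i\<in>UNIV. t $ i *\<^sub>R p i) = g + u *\<^sub>R (p j - g)"
  proof -
    have "(\<Sum>i\<in>UNIV. t $ i *\<^sub>R p i)
        = (\<Sum>i\<in>UNIV. (1 - u) *\<^sub>R (\<theta> $ i *\<^sub>R p i) + (if i = j then u *\<^sub>R p i else 0))"
      by (intro sum.cong) (auto simp: tj algebra_simps)
    also have "\<dots> = (1 - u) *\<^sub>R g + u *\<^sub>R p j"
      by (simp add: sum.distrib g_def scaleR_sum_right)
    finally show ?thesis by (simp add: algebra_simps)
  qed
  moreover have "s *\<^sub>R (g + u *\<^sub>R (p j - g)) - m = ?w + u *\<^sub>R ?d"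
    by (simp add: algebra_simps)
  ultimately have "\<not> (norm (?w + u *\<^sub>R ?d))\<^sup>2 < (norm ?w)\<^sup>2"
    using assms(1) unfolding is_arg_min_def g_def by metis
  with u(3) show False
    by (simp add: dist_norm power_strict_mono)
qed

lemma convex_combination_bound:
  fixes \<theta> :: "real ^ 'm::finite"
  assumes "\<theta> \<in> std_simplex" and "\<And>i. c \<le> a i"
  shows "c \<le> (\<Sum>i\<in>UNIV. \<theta> $ i * a i)"
proof -
  have "c = (\<Sum>i\<in>UNIV. \<theta> $ i * c)"
    using assms(1) by (simp add: std_simplex_def flip: sum_distrib_right)
  also have "\<dots> \<le> (\<Sum>i\<in>UNIV. \<theta> $ i * a i)"
    using assms by (intro sum_mono mult_left_mono) (auto simp: std_simplex_def)
  finally show ?thesis .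
qed

section \<open>One step of the accelerated method\<close>

text \<open>The supremum of \<open>gap f a\<close> over its last argument is the usual merit function for weak Pareto
  optimality of \<open>a\<close>; it is kept as a function of \<open>z\<close> because the energy depends on \<open>z\<close>.\<close>

definition gap :: "('a \<Rightarrow> real ^ 'm::finite) \<Rightarrow> 'a \<Rightarrow> 'a \<Rightarrow> real" where
  "gap f a z = (MIN i. f a $ i - f z $ i)"

lemma gap_le: "gap f a z \<le> f a $ i - f z $ i"
  unfolding gap_def by (rule Min_le) auto

lemma gap_geI: "(\<And>i. c \<le> f a $ i - f z $ i) \<Longrightarrow> c \<le> gap f a z"
  unfolding gap_def by (subst Min_ge_iff) auto

lemma gap_diff_le:
  assumes "\<And>i. f b $ i - f a $ i \<le> c"
  shows "gap f b z - gap f a z \<le> c"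
proof -
  have "gap f b z - c \<le> f a $ i - f z $ i" for i
    using gap_le[of f b z i] assms[of i] by linarith
  then have "gap f b z - c \<le> gap f a z" by (rule gap_geI)
  then show ?thesis by simp
qed

text \<open>Descent from \<open>y = a + m\<close> to \<open>b\<close> combined with convexity between \<open>y\<close> and \<open>a\<close> leaves the term
  \<open>\<nabla>f\<^sub>i(y) \<bullet> (b - a)\<close>. Minimality of \<open>\<theta>\<close> says that it is at most \<open>g \<bullet> (b - a)\<close>, which no longer depends
  on \<open>i\<close>. This common bound is a difference of kinetic energies: what a component gains is paid for
  by the momentum, and velocity left after the step lowers every component.\<close>

lemma component_decrease:
  fixes f :: "'a::real_inner \<Rightarrow> real ^ 'm::finite"
  assumes convex: "\<And>i. convex_on UNIV (\<lambda>z. f z $ i)"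
    and grad: "\<And>i z. GDERIV (\<lambda>w. f w $ i) z :> grad i z"
    and lip: "\<And>i. L-lipschitz_on UNIV (grad i)"
    and s: "0 < s" "L \<le> 1 / s"
    and min: "is_arg_min (\<lambda>t. (norm (s *\<^sub>R (\<Sum>i\<in>UNIV. t $ i *\<^sub>R grad i (a + m)) - m))\<^sup>2)
        (\<lambda>t. t \<in> std_simplex) \<theta>"
    and b: "b = a + m - s *\<^sub>R (\<Sum>i\<in>UNIV. \<theta> $ i *\<^sub>R grad i (a + m))"
  shows "f b $ i - f a $ i \<le> ((norm m)\<^sup>2 - (norm (b - a))\<^sup>2) / (2 * s)"
proof -
  define y where "y = a + m"
  define g where "g = (\<Sum>i\<in>UNIV. \<theta> $ i *\<^sub>R grad i y)"
  have ba: "b - a = m - s *\<^sub>R g" and norm_sg: "norm (b - y) = norm (s *\<^sub>R g)"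
    by (simp_all add: b g_def y_def)
  have "f b $ i \<le> f y $ i + grad i y \<bullet> (b - y) + L / 2 * (norm (b - y))\<^sup>2"
    by (rule descent_lemma[OF grad lip])
  also have "L / 2 * (norm (b - y))\<^sup>2 \<le> 1 / s / 2 * (norm (b - y))\<^sup>2"
    using s by (intro mult_right_mono divide_right_mono) auto
  finally have "f b $ i - f a $ i \<le> grad i y \<bullet> (b - a) + (norm (s *\<^sub>R g))\<^sup>2 / (2 * s)"
    using gradient_inequality[OF convex grad, of i y a] by (simp add: inner_diff_right mult.commute flip: norm_sg del: norm_scaleR)
  also have "grad i y \<bullet> (b - a) \<le> g \<bullet> (b - a)"
  proof -
    have "0 \<le> (s *\<^sub>R g - m) \<bullet> (s *\<^sub>R (grad i y - g))"
      using simplex_min_norm_variational[OF min] by (simp add: g_def y_def)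
    also have "\<dots> = s * (g \<bullet> (b - a) - grad i y \<bullet> (b - a))"
      by (simp add: ba inner_commute algebra_simps)
    finally show ?thesis using s(1) by (simp add: zero_le_mult_iff)
  qed
  also have "g \<bullet> (b - a) + (norm (s *\<^sub>R g))\<^sup>2 / (2 * s)
      = ((norm m)\<^sup>2 - (norm (b - a))\<^sup>2) / (2 * s)"
    using s(1) unfolding ba power2_norm_eq_inner
    by (simp add: inner_diff_left inner_diff_right inner_commute divide_simps) (simp add: algebra_simps)
  finally show ?thesis by simp
qed

text \<open>Each component satisfies the bound with its own gradient. The smallest of the differences is
  below their average with weights \<open>\<theta>\<close>, and averaging turns the gradients into \<open>g\<close>.\<close>

lemma gap_after_gradient_step:
  fixes f :: "'a::real_inner \<Rightarrow> real ^ 'm::finite" and y :: 'a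
  assumes convex: "\<And>i. convex_on UNIV (\<lambda>z. f z $ i)"
    and grad: "\<And>i z. GDERIV (\<lambda>w. f w $ i) z :> grad i z"
    and lip: "\<And>i. L-lipschitz_on UNIV (grad i)"
    and s: "0 < s" "L \<le> 1 / s"
    and \<theta>: "\<theta> \<in> std_simplex"
  defines "g \<equiv> \<Sum>i\<in>UNIV. \<theta> $ i *\<^sub>R grad i y"
  shows "gap f (y - s *\<^sub>R g) z \<le> g \<bullet> (y - z) - s / 2 * (norm g)\<^sup>2"
proof -
  let ?b = "y - s *\<^sub>R g"
  let ?c = "L / 2 * (norm (s *\<^sub>R g))\<^sup>2"
  have "f ?b $ i - f z $ i \<le> grad i y \<bullet> (?b - z) + ?c" for i
    using descent_lemma[OF grad lip, where z = ?b and y = y, of i]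
      gradient_inequality[OF convex grad, of i y z] by (simp add: inner_diff_right)
  then have "gap f ?b z - ?c \<le> grad i y \<bullet> (?b - z)" for i
    using gap_le[of f ?b z i] by (smt (verit))
  then have "gap f ?b z - ?c \<le> (\<Sum>i\<in>UNIV. \<theta> $ i * (grad i y \<bullet> (?b - z)))"
    by (rule convex_combination_bound[OF \<theta>])
  also have "\<dots> = g \<bullet> (?b - z)"
    by (simp add: g_def inner_sum_left)
  finally have "gap f ?b z \<le> g \<bullet> (?b - z) + ?c" by simp
  also have "?c \<le> 1 / s / 2 * (norm (s *\<^sub>R g))\<^sup>2"
    using s by (intro mult_right_mono divide_right_mono) auto
  also have "g \<bullet> (?b - z) + 1 / s / 2 * (norm (s *\<^sub>R g))\<^sup>2 = g \<bullet> (y - z) - s / 2 * (norm g)\<^sup>2"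
    using s(1) unfolding power2_norm_eq_inner
    by (simp add: inner_diff_right divide_simps)
  finally show ?thesis by simp
qed

section \<open>A nonincreasing energy\<close>

text \<open>The last square is Nesterov's auxiliary sequence \<open>x\<^sup>k + (t\<^sub>k - 1)(x\<^sup>k - x\<^sup>k\<^sup>-\<^sup>1)\<close> with
  \<open>t\<^sub>k = (k + 1)/2\<close>. His weight \<open>t\<^sub>k\<^sup>2\<close> of the gap is replaced by \<open>k (k + 3)/4\<close> and a velocity term is added;
  these two changes belong together and make the energy monotone without any sign
  condition on the gap.\<close>

definition energy :: "real \<Rightarrow> ('a::real_inner \<Rightarrow> real ^ 'm::finite) \<Rightarrow> 'a \<Rightarrow> (nat \<Rightarrow> 'a) \<Rightarrow> nat \<Rightarrow> real" where
  "energy s f z x k = (real k * (real k + 3)) / 4 * gap f (x k) z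
     + ((real k - 1) / 4 * (norm (x k - x (k - 1)))\<^sup>2
       + (norm (x k + ((real k - 1) / 2) *\<^sub>R (x k - x (k - 1)) - z))\<^sup>2) / (2 * s)"

text \<open>The first bound keeps the iterates in the level set. The second is what the extra weight \<open>k/4\<close>
  costs: the velocity term with coefficient \<open>k - 1\<close> pays for the momentum with coefficient \<open>k\<close>.\<close>

lemma momentum_norm_bounds:
  assumes "k \<ge> 1"
  shows "(norm (momentum x k))\<^sup>2 \<le> (norm (x k - x (k - 1)))\<^sup>2"
    and "real k * (norm (momentum x k))\<^sup>2 \<le> (real k - 1) * (norm (x k - x (k - 1)))\<^sup>2"
proof -
  define q where "q = (real k - 1) / (real k + 2)"
  have q: "0 \<le> q" "q \<le> 1" "real k * q \<le> real k - 1"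
    using assms by (auto simp: q_def field_simps)
  have norm: "(norm (momentum x k))\<^sup>2 = q\<^sup>2 * (norm (x k - x (k - 1)))\<^sup>2"
    by (simp add: momentum_def q_def power_mult_distrib power_divide)
  show "(norm (momentum x k))\<^sup>2 \<le> (norm (x k - x (k - 1)))\<^sup>2"
    unfolding norm using q by (simp add: mult_left_le_one_le power_le_one)
  have "real k * q\<^sup>2 \<le> real k * q"
    using q by (intro mult_left_mono) (auto simp: power2_eq_square mult_left_le)
  also note q(3)
  finally show "real k * (norm (momentum x k))\<^sup>2 \<le> (real k - 1) * (norm (x k - x (k - 1)))\<^sup>2"
    unfolding norm by (simp add: mult_right_mono flip: mult.assoc)
qed

text \<open>The two one-step estimates enter as hypotheses, and the rest is algebra. With \<open>T = (k + 2)/2\<close>, the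
  choice of the momentum factor makes \<open>x\<^sup>k + T m\<close> the auxiliary point of step \<open>k\<close> and
  \<open>x\<^sup>k + T (m - s g)\<close> the one of step \<open>k + 1\<close>, so the change of the last square in the energy is that
  of a gradient step of length \<open>s T\<close> along \<open>g\<close>.\<close>

lemma energy_decrease:
  fixes f :: "'a::real_inner \<Rightarrow> real ^ 'm::finite"
  assumes k: "k \<ge> 1" and s: "0 < s"
    and step: "x (k + 1) = x k + momentum x k - s *\<^sub>R g"
    and descent: "gap f (x (k + 1)) z - gap f (x k) z
        \<le> ((norm (momentum x k))\<^sup>2 - (norm (x (k + 1) - x k))\<^sup>2) / (2 * s)"
    and gap: "gap f (x (k + 1)) z \<le> g \<bullet> (x k + momentum x k - z) - s / 2 * (norm g)\<^sup>2"
  shows "energy s f z x (k + 1) \<le> energy s f z x k"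
proof -
  define K where "K = real k"
  have K: "K \<ge> 1" using k by (simp add: K_def)
  define m v where "m = momentum x k" and "v = x k - x (k - 1)"
  define T where "T = (K + 2) / 2"
  define A B where "A = gap f (x k) z" and "B = gap f (x (k + 1)) z"
  define e where "e = x k - z"
  let ?u = "e + T *\<^sub>R m" and ?w = "m - s *\<^sub>R g"
  have diff: "x (k + 1) - x k = ?w"
    unfolding step m_def by simp
  have u: "x k + ((K - 1) / 2) *\<^sub>R v - z = ?u"
  proof -
    have "T *\<^sub>R m = (T * ((K - 1) / (K + 2))) *\<^sub>R v"
      by (simp add: m_def momentum_def K_def v_def)
    also have "T * ((K - 1) / (K + 2)) = (K - 1) / 2"
      using K by (simp add: T_def divide_simps)
    finally show ?thesis by (simp add: e_def)
  qed
  have u': "x (k + 1) + (K / 2) *\<^sub>R ?w - z = ?u - (s * T) *\<^sub>R g"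
  proof -
    have T: "T = 1 + K / 2" by (simp add: T_def)
    show ?thesis unfolding step T by (simp add: e_def m_def algebra_simps)
  qed
  have d: "B - A \<le> ((norm m)\<^sup>2 - (norm ?w)\<^sup>2) / (2 * s)"
    using descent unfolding A_def B_def diff by (simp add: m_def)
  \<comment> \<open>Nesterov's combination of the two estimates: the weights are the ones for which the
    inner products with \<open>g\<close> recombine into the auxiliary point.\<close>
  have square: "T * (T - 1) * (B - A) + T * B
      \<le> ((norm ?u)\<^sup>2 - (norm (?u - (s * T) *\<^sub>R g))\<^sup>2) / (2 * s)"
  proof -
    have "T * (T - 1) * (B - A) \<le> T * (T - 1) * (((norm m)\<^sup>2 - (norm ?w)\<^sup>2) / (2 * s))"
      using d K by (intro mult_left_mono) (auto simp: T_def)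
    moreover have "T * B \<le> T * (g \<bullet> (e + m) - s / 2 * (norm g)\<^sup>2)"
      using gap K by (intro mult_left_mono) (auto simp: T_def B_def e_def m_def algebra_simps)
    moreover have "T * (T - 1) * (((norm m)\<^sup>2 - (norm ?w)\<^sup>2) / (2 * s))
        + T * (g \<bullet> (e + m) - s / 2 * (norm g)\<^sup>2)
        = ((norm ?u)\<^sup>2 - (norm (?u - (s * T) *\<^sub>R g))\<^sup>2) / (2 * s)"
      using s unfolding power2_norm_eq_inner
      by (simp add: inner_diff_left inner_diff_right inner_add_left inner_add_right
          inner_commute divide_simps)
        (simp add: algebra_simps inner_commute)
    ultimately show ?thesis by linarith
  qed
  \<comment> \<open>The extra use of the descent estimate, whose weight \<open>K / 4\<close> is dictated by \<open>weights\<close> below.\<close>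
  have "K / 4 * (B - A) \<le> K / 4 * (((norm m)\<^sup>2 - (norm ?w)\<^sup>2) / (2 * s))"
    using d K by (intro mult_left_mono) auto
  also have "\<dots> = (K * (norm m)\<^sup>2 - K * (norm ?w)\<^sup>2) / (8 * s)"
    using s by (simp add: field_simps)
  also have "\<dots> \<le> ((K - 1) * (norm v)\<^sup>2 - K * (norm ?w)\<^sup>2) / (8 * s)"
    using momentum_norm_bounds(2)[OF k, of x] s
    by (intro divide_right_mono) (auto simp: K_def m_def v_def)
  finally have kinetic: "K / 4 * (B - A) \<le> ((K - 1) * (norm v)\<^sup>2 - K * (norm ?w)\<^sup>2) / (8 * s)" .
  \<comment> \<open>The coefficient of the old gap is that of the new one with \<open>K\<close> in place of \<open>K + 1\<close>; without the
    summand \<open>K / 4 * (B - A)\<close> the two would differ by a multiple of the gap of unknown sign.\<close>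
  have weights: "T * (T - 1) * (B - A) + T * B + K / 4 * (B - A)
      = (K + 1) * (K + 4) / 4 * B - K * (K + 3) / 4 * A"
    by (simp add: T_def field_simps)
  have "energy s f z x (k + 1) = (K + 1) * (K + 4) / 4 * B
      + (K / 4 * (norm ?w)\<^sup>2 + (norm (?u - (s * T) *\<^sub>R g))\<^sup>2) / (2 * s)"
    using u' by (simp add: energy_def B_def K_def diff[simplified] add.commute)
  moreover have "energy s f z x k = K * (K + 3) / 4 * A
      + ((K - 1) / 4 * (norm v)\<^sup>2 + (norm ?u)\<^sup>2) / (2 * s)"
    unfolding u[symmetric] by (simp add: energy_def A_def K_def v_def)
  moreover have "((K - 1) * (norm v)\<^sup>2 - K * (norm ?w)\<^sup>2) / (8 * s)
      + ((norm ?u)\<^sup>2 - (norm (?u - (s * T) *\<^sub>R g))\<^sup>2) / (2 * s)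
    = ((K - 1) / 4 * (norm v)\<^sup>2 + (norm ?u)\<^sup>2) / (2 * s)
      - (K / 4 * (norm ?w)\<^sup>2 + (norm (?u - (s * T) *\<^sub>R g))\<^sup>2) / (2 * s)"
    using s by (simp add: field_simps)
  ultimately show ?thesis
    using square kinetic weights by linarith
qed

section \<open>Convergence rate of the merit function\<close>

theorem theorem6p7:
  fixes f :: "'a::{real_inner, complete_space} \<Rightarrow> real ^ 'm"
    and grad :: "'m \<Rightarrow> 'a \<Rightarrow> 'a"
    and L s :: real
    and x y :: "nat \<Rightarrow> 'a"
    and \<theta> :: "nat \<Rightarrow> real ^ 'm"
  defines "Lstar \<equiv> weakly_pareto f \<inter> lower_level_set f (f (x 0))"
  assumes f_convex: "\<And>i. convex_on UNIV (\<lambda>z. f z $ i)"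
    and f_grad: "\<And>i z. GDERIV (\<lambda>w. f w $ i) z :> grad i z"
    and grad_lipschitz: "\<And>i. L-lipschitz_on UNIV (grad i)"
    and L_pos: "L > 0"
    and s_pos: "0 < s" and s_le: "s \<le> 1 / L"
    and init: "x 0 = x 1"
    and y_step: "\<And>k. k \<ge> 1 \<Longrightarrow> y k = x k + momentum x k"
    and theta_min: "\<And>k. k \<ge> 1 \<Longrightarrow>
      is_arg_min (\<lambda>t. (norm (s *\<^sub>R (\<Sum>i\<in>UNIV. t $ i *\<^sub>R grad i (y k)) - momentum x k))\<^sup>2)
        (\<lambda>t. t \<in> std_simplex) (\<theta> k)"
    and x_step: "\<And>k. k \<ge> 1 \<Longrightarrow>
      x (k + 1) = y k - s *\<^sub>R (\<Sum>i\<in>UNIV. \<theta> k $ i *\<^sub>R grad i (y k))"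
    and dominated: "\<And>z. z \<in> lower_level_set f (f (x 0)) \<Longrightarrow>
      \<exists>zs\<in>Lstar. \<forall>i. f zs $ i \<le> f z $ i"
    and finite_sup: "(SUP fs\<in>f ` Lstar. INF z\<in>f -` {fs}. ereal (norm (z - x 0))) < \<infinity>"
  shows "\<exists>R::real. R \<ge> 0 \<and> (\<forall>k\<ge>1.
    (SUP z. ereal (MIN i. f (x k) $ i - f z $ i)) \<le> ereal (R / (real k + 1)\<^sup>2))"
proof -
  have Ls: "L \<le> 1 / s"
    using L_pos s_pos s_le by (simp add: field_simps)
  have decrease: "f (x (k + 1)) $ i - f (x k) $ i
      \<le> ((norm (momentum x k))\<^sup>2 - (norm (x (k + 1) - x k))\<^sup>2) / (2 * s)" if "k \<ge> 1" for k i
    using theta_min[OF that] x_step[OF that] unfolding y_step[OF that]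
    by (rule component_decrease[OF f_convex f_grad grad_lipschitz s_pos Ls])
  have energy_Suc: "energy s f z x (k + 1) \<le> energy s f z x k" if "k \<ge> 1" for k z
  proof (rule energy_decrease[OF that s_pos])
    let ?g = "\<Sum>i\<in>UNIV. \<theta> k $ i *\<^sub>R grad i (y k)"
    show "x (k + 1) = x k + momentum x k - s *\<^sub>R ?g"
      using x_step[OF that] y_step[OF that] by simp
    show "gap f (x (k + 1)) z - gap f (x k) z
        \<le> ((norm (momentum x k))\<^sup>2 - (norm (x (k + 1) - x k))\<^sup>2) / (2 * s)"
      by (rule gap_diff_le) (rule decrease[OF that])
    have "\<theta> k \<in> std_simplex"
      using theta_min[OF that] by (simp add: is_arg_min_def)
    from gap_after_gradient_step[OF f_convex f_grad grad_lipschitz s_pos Ls this, of "y k" z]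
    show "gap f (x (k + 1)) z \<le> ?g \<bullet> (x k + momentum x k - z) - s / 2 * (norm ?g)\<^sup>2"
      unfolding x_step[OF that] by (simp only: y_step[OF that])
  qed
  have energy_le: "energy s f z x k \<le> energy s f z x 1" if "k \<ge> 1" for k z
    using that by (induction k rule: dec_induct) (simp, metis Suc_eq_plus1 energy_Suc order_trans)
  have level: "f (x k) $ i \<le> f (x 0) $ i" if "k \<ge> 1" for k i
  proof -
    \<comment> \<open>The method is not a descent method; objective plus kinetic energy is what decreases, and the
      kinetic energy vanishes at the start.\<close>
    have "f (x k) $ i + (norm (x k - x (k - 1)))\<^sup>2 / (2 * s) \<le> f (x 0) $ i"
      using that
    proof (induction k rule: dec_induct)
      case base
      then show ?case by (simp add: init)
    next
      case (step n)
      have "(norm (momentum x n))\<^sup>2 / (2 * s) \<le> (norm (x n - x (n - 1)))\<^sup>2 / (2 * s)"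
        using momentum_norm_bounds(1)[OF step(1), of x] s_pos by (intro divide_right_mono) auto
      then show ?case
        using decrease[OF step(1), of i] step.IH by (simp add: diff_divide_distrib)
    qed
    moreover have "0 \<le> (norm (x k - x (k - 1)))\<^sup>2 / (2 * s)"
      using s_pos by simp
    ultimately show ?thesis by linarith
  qed
  obtain D where D: "D \<ge> 0"
    and near: "\<And>zs. zs \<in> Lstar \<Longrightarrow> \<exists>z. f z = f zs \<and> norm (z - x 0) \<le> D"
  proof -
    obtain r where r: "(SUP fs\<in>f ` Lstar. INF z\<in>f -` {fs}. ereal (norm (z - x 0))) < ereal r"
      using finite_sup less_PInf_Ex_of_nat by (metis less_ereal.simps(4) ereal_dense2)
    show thesis
    proof
      show "max r 0 \<ge> 0" by simp
      fix zs assume "zs \<in> Lstar"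
      then have "(INF z\<in>f -` {f zs}. ereal (norm (z - x 0))) < ereal r"
        using r by (meson SUP_upper imageI order_le_less_trans)
      then obtain z where "z \<in> f -` {f zs}" "ereal (norm (z - x 0)) < ereal r"
        by (auto simp: INF_less_iff)
      then show "\<exists>z. f z = f zs \<and> norm (z - x 0) \<le> max r 0"
        by (intro exI[of _ z]) auto
    qed
  qed
  \<comment> \<open>Some objective has to be chosen to bound the initial gap, and \<open>undefined\<close> names an arbitrary
    index.\<close>
  define G where "G = norm (grad undefined (x 0))"
  define R where "R = 4 * (G * D + D\<^sup>2 / (2 * s))"
  have R: "R \<ge> 0"
    using D s_pos by (simp add: R_def G_def)
  have near_bound: "gap f (x k) z \<le> R / (real k + 1)\<^sup>2"
    if k: "k \<ge> 1" and z: "norm (z - x 0) \<le> D" and pos: "0 < gap f (x k) z" for k z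
  proof -
    have "gap f (x 1) z \<le> G * D"
    proof -
      have "gap f (x 1) z \<le> f (x 0) $ undefined - f z $ undefined"
        using gap_le[of f "x 1" z] by (simp add: init)
      also have "\<dots> \<le> grad undefined (x 0) \<bullet> (x 0 - z)"
        using gradient_inequality[OF f_convex f_grad, of undefined "x 0" z]
        by (simp add: inner_diff_right)
      also have "\<dots> \<le> G * norm (x 0 - z)"
        unfolding G_def by (rule norm_cauchy_schwarz)
      also have "\<dots> \<le> G * D"
        using z by (intro mult_left_mono) (auto simp: norm_minus_commute G_def)
      finally show ?thesis .
    qed
    moreover have "(norm (x 0 - z))\<^sup>2 / (2 * s) \<le> D\<^sup>2 / (2 * s)"
      using z s_pos by (intro divide_right_mono power_mono) (auto simp: norm_minus_commute)
    moreover have "real k * (real k + 3) / 4 * gap f (x k) z \<le> energy s f z x k"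
      using k s_pos by (simp add: energy_def)
    moreover have "energy s f z x 1 = gap f (x 1) z + (norm (x 0 - z))\<^sup>2 / (2 * s)"
      by (simp add: energy_def init)
    ultimately have "real k * (real k + 3) / 4 * gap f (x k) z \<le> R / 4"
      using energy_le[OF k, of z] by (simp add: R_def)
    \<comment> \<open>Here \<open>(k + 1)\<^sup>2 \<le> k (k + 3)\<close> needs \<open>k \<ge> 1\<close>.\<close>
    moreover have "(real k + 1)\<^sup>2 * gap f (x k) z \<le> real k * (real k + 3) * gap f (x k) z"
      using k pos by (intro mult_right_mono) (auto simp: power2_eq_square algebra_simps)
    ultimately have "(real k + 1)\<^sup>2 * gap f (x k) z \<le> R" by simp
    then show ?thesis
      using k by (simp add: pos_le_divide_eq mult.commute)
  qed
  have "gap f (x k) z \<le> R / (real k + 1)\<^sup>2" if k: "k \<ge> 1" for k z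
  proof (cases "0 < gap f (x k) z")
    case True
    have "f z $ i \<le> f (x 0) $ i" for i
      using True gap_le[of f "x k" z i] level[OF k, of i] by linarith
    then obtain zs where zs: "zs \<in> Lstar" "\<And>i. f zs $ i \<le> f z $ i"
      using dominated[of z] by (auto simp: lower_level_set_def)
    from near[OF zs(1)] obtain z' where z': "f z' = f zs" "norm (z' - x 0) \<le> D"
      by blast
    have le: "gap f (x k) z \<le> gap f (x k) z'"
    proof (rule gap_geI)
      fix i show "gap f (x k) z \<le> f (x k) $ i - f z' $ i"
        using gap_le[of f "x k" z i] zs(2)[of i] z'(1) by simp
    qed
    with True near_bound[OF k z'(2)] show ?thesis by simp
  next
    case False
    moreover have "0 \<le> R / (real k + 1)\<^sup>2" using R by simp
    ultimately show ?thesis by linarith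
  qed
  then have "\<forall>k\<ge>1. (SUP z. ereal (MIN i. f (x k) $ i - f z $ i)) \<le> ereal (R / (real k + 1)\<^sup>2)"
    unfolding gap_def by (auto intro!: SUP_least)
  with R show ?thesis by blast
qed

end
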